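(* Let $m\ge1$ be an integer. Consider the $m$-row-restricted slicings, growing from the single cell. The children of a slicing are obtained by adding either a new horizontal block as a new topmost row, right-aligned with the bounding rectangle, or a new vertical block as a new rightmost column, top-aligned with the bounding rectangle, in all ways such that the result is an $m$-row-restricted slicing. Label each slicing by $(h,k)$, where $h$ is the maximal width of an addable horizontal block and $k$ is the height of the rightmost column. Then the root is labelled $(1,1)$, and the children of a slicing with label $(h,k)$ have labels given by the following rule $(\Upsilon_m)$: - $(1,k+1),(2,k+1),\ldots,(h,k+1)$; - together with $(h+1,1),(h+1,2),\ldots,(h+1,k)$ if $h<m$; - together with $(m,1),(m,2),\ldots,(m,k)$ if $h=m$.
   Context: Parallelogram polyominoes are edge-connected sets of unit cells bounded by two lattice paths with steps $(0,1)$ and $(1,0)$ meeting only at their endpoints. The size is $k+\ell-1$ for a $k\times\ell$ bounding rectangle. A Baxter slicing of size $n$ is such a polyomino of size $n$ divided into $n$ blocks, defined recursively: - for $n=1$, the single cell is the single block; - for $n\ge2$, one block is the topmost row (horizontal block) or the rightmost column (vertical block), and the other blocks form a Baxter slicing of the polyomino obtained by deleting it. An $m$-row-restricted slicing is a Baxter slicing all of whose horizontal blocks have width at most $m$. *)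

theory Defs
  imports "HOL-Library.Multiset"
begin

datatype step = North | East

definition endpoint :: "step list \<Rightarrow> nat \<times> nat" where
  "endpoint w = (count_list w East, count_list w North)"

definition path_points :: "step list \<Rightarrow> (nat \<times> nat) set" where
  "path_points w = {endpoint (take t w) | t. t \<le> length w}"

text \<open>The path \<open>w\<close>, started at the origin, contains the edge from \<open>(i, y)\<close> to \<open>(i + 1, y)\<close>.\<close>

definition east_edge :: "step list \<Rightarrow> nat \<Rightarrow> nat \<Rightarrow> bool" where
  "east_edge w i y \<longleftrightarrow> (\<exists>t < length w. w ! t = East \<and> endpoint (take t w) = (i, y))"

text \<open>The cell \<open>(i, j)\<close> is the unit square with lower left corner \<open>(i, j)\<close>.\<close>

type_synonym cell = "nat \<times> nat"

definition cells_between :: "step list \<Rightarrow> step list \<Rightarrow> cell set" where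
  "cells_between u l = {(i, j). \<exists>a b. east_edge l i a \<and> east_edge u i b \<and> a \<le> j \<and> j < b}"

definition edge_adjacent :: "cell \<Rightarrow> cell \<Rightarrow> bool" where
  "edge_adjacent c d \<longleftrightarrow>
     (fst c = fst d \<and> (snd d = Suc (snd c) \<or> snd c = Suc (snd d))) \<or>
     (snd c = snd d \<and> (fst d = Suc (fst c) \<or> fst c = Suc (fst d)))"

definition edge_connected :: "cell set \<Rightarrow> bool" where
  "edge_connected P \<longleftrightarrow>
     (\<forall>c \<in> P. \<forall>d \<in> P. (c, d) \<in> {(a, b). a \<in> P \<and> b \<in> P \<and> edge_adjacent a b}\<^sup>*)"

text \<open>
  Polyominoes are considered up to translation: the common starting point of the two boundary
  paths is placed at the origin. The upper path starts with a north step and the lower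
  path with an east step, which also excludes that the two paths coincide.
\<close>

definition parallelogram_polyomino :: "cell set \<Rightarrow> bool" where
  "parallelogram_polyomino P \<longleftrightarrow> edge_connected P \<and>
     (\<exists>u l u' l'. u = North # u' \<and> l = East # l' \<and>
        endpoint u = endpoint l \<and>
        path_points u \<inter> path_points l = {(0, 0), endpoint u} \<and>
        P = cells_between u l)"

text \<open>
  Dimensions of the bounding rectangle; its lower left corner is the origin.
\<close>

definition pp_width :: "cell set \<Rightarrow> nat" where
  "pp_width P = Max (fst ` P) + 1"

definition pp_height :: "cell set \<Rightarrow> nat" where
  "pp_height P = Max (snd ` P) + 1"

definition pp_size :: "cell set \<Rightarrow> nat" where
  "pp_size P = pp_width P + pp_height P - 1"

definition top_row :: "cell set \<Rightarrow> cell set" where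
  "top_row P = {c \<in> P. snd c = Max (snd ` P)}"

definition right_column :: "cell set \<Rightarrow> cell set" where
  "right_column P = {c \<in> P. fst c = Max (fst ` P)}"

text \<open>A slicing consists of a polyomino and its set of blocks.\<close>

type_synonym slicing = "cell set \<times> cell set set"

definition single_cell :: slicing where
  "single_cell = ({(0, 0)}, {{(0, 0)}})"

inductive baxter_slicing :: "nat \<Rightarrow> slicing \<Rightarrow> bool" where
  single: "baxter_slicing 1 single_cell"
| horizontal: "parallelogram_polyomino P \<Longrightarrow> pp_size P = Suc n \<Longrightarrow>
    baxter_slicing n (P - top_row P, B) \<Longrightarrow>
    baxter_slicing (Suc n) (P, insert (top_row P) B)"
| vertical: "parallelogram_polyomino P \<Longrightarrow> pp_size P = Suc n \<Longrightarrow>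
    baxter_slicing n (P - right_column P, B) \<Longrightarrow>
    baxter_slicing (Suc n) (P, insert (right_column P) B)"

text \<open>
  A block consisting of one cell counts as horizontal here even if it was cut off as a column.
  This does not affect the next definition for \<open>m \<ge> 1\<close>, as such a block has width 1.
\<close>

definition horizontal_block :: "cell set \<Rightarrow> bool" where
  "horizontal_block b \<longleftrightarrow> (\<exists>y. \<forall>c \<in> b. snd c = y)"

definition row_restricted_slicing :: "nat \<Rightarrow> slicing \<Rightarrow> bool" where
  "row_restricted_slicing m S \<longleftrightarrow> (\<exists>n. baxter_slicing n S) \<and>
     (\<forall>b \<in> snd S. horizontal_block b \<longrightarrow> card (fst ` b) \<le> m)"

text \<open>
  The added row of width \<open>w\<close> is right-aligned, the added column of height \<open>v\<close> top-aligned
  with the bounding rectangle. They are only used with \<open>w\<close> at most the width and \<open>v\<close> at most the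
  height of that rectangle, so that the subtractions do not truncate; a longer block would
  protrude from the rectangle on the left or below.
\<close>

definition new_row :: "cell set \<Rightarrow> nat \<Rightarrow> cell set" where
  "new_row P w = {pp_width P - w ..< pp_width P} \<times> {pp_height P}"

definition new_column :: "cell set \<Rightarrow> nat \<Rightarrow> cell set" where
  "new_column P v = {pp_width P} \<times> {pp_height P - v ..< pp_height P}"

definition add_block :: "cell set \<Rightarrow> slicing \<Rightarrow> slicing" where
  "add_block b S = (fst S \<union> b, insert b (snd S))"

definition addable_widths :: "nat \<Rightarrow> slicing \<Rightarrow> nat set" where
  "addable_widths m S = {w \<in> {1..pp_width (fst S)}.
     row_restricted_slicing m (add_block (new_row (fst S) w) S)}"

definition addable_heights :: "nat \<Rightarrow> slicing \<Rightarrow> nat set" where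
  "addable_heights m S = {v \<in> {1..pp_height (fst S)}.
     row_restricted_slicing m (add_block (new_column (fst S) v) S)}"

definition children :: "nat \<Rightarrow> slicing \<Rightarrow> slicing set" where
  "children m S =
     (\<lambda>w. add_block (new_row (fst S) w) S) ` addable_widths m S \<union>
     (\<lambda>v. add_block (new_column (fst S) v) S) ` addable_heights m S"

definition label :: "nat \<Rightarrow> slicing \<Rightarrow> nat \<times> nat" where
  "label m S = (Max (addable_widths m S), card (right_column (fst S)))"

definition upsilon_rule :: "nat \<Rightarrow> nat \<Rightarrow> nat \<Rightarrow> (nat \<times> nat) multiset" where
  "upsilon_rule m h k =
     {#(i, k + 1). i \<in># mset_set {1..h}#} +
     (if h < m then {#(h + 1, j). j \<in># mset_set {1..k}#} else {#}) +
     (if h = m then {#(m, j). j \<in># mset_set {1..k}#} else {#})"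

end

theory Submission
  imports Defs
begin

text \<open>
  A parallelogram polyomino is a row of columns whose bottoms \<open>a i\<close> and tops \<open>b i\<close> both increase
  weakly, with consecutive columns overlapping. In this description a right-aligned row can be put
  on top exactly when it is at most as wide as the current top row, and a top-aligned column
  can be put on the right exactly when it is at most as high as the current rightmost column. Hence
  the label of a slicing is the pair of \<open>min m r\<close> and \<open>k\<close>, where \<open>r\<close> is the width of the top row and
  \<open>k\<close> the height of the rightmost column. A new row of width \<open>w\<close> turns \<open>(r, k)\<close> into \<open>(w, k + 1)\<close>,
  and a new column of height \<open>v\<close> turns it into \<open>(r + 1, v)\<close>.
\<close>

section \<open>Lattice paths\<close>

lemma endpoint_snoc:
  "endpoint (w @ [s]) = (if s = East then (Suc (fst (endpoint w)), snd (endpoint w))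
     else (fst (endpoint w), Suc (snd (endpoint w))))"
  by (cases s) (auto simp: endpoint_def)

lemma endpoint_append_North: "endpoint (w @ replicate c North) = (fst (endpoint w), snd (endpoint w) + c)"
proof (induction c)
  case (Suc c)
  then show ?case
    using endpoint_snoc[of "w @ replicate c North" North] by (simp add: replicate_append_same)
qed simp

lemma path_points_snoc: "path_points (w @ [s]) = insert (endpoint (w @ [s])) (path_points w)"
proof -
  have "path_points (w @ [s]) = (\<lambda>t. endpoint (take t (w @ [s]))) ` {..Suc (length w)}"
    by (auto simp: path_points_def)
  also have "\<dots> = insert (endpoint (w @ [s])) ((\<lambda>t. endpoint (take t (w @ [s]))) ` {..length w})"
    by (simp add: atMost_Suc)
  also have "(\<lambda>t. endpoint (take t (w @ [s]))) ` {..length w} = path_points w"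
    by (auto simp: path_points_def)
  finally show ?thesis .
qed

lemma path_points_append_North:
  "path_points (w @ replicate c North) =
     path_points w \<union> {fst (endpoint w)} \<times> {snd (endpoint w)..snd (endpoint w) + c}"
proof (induction c)
  case 0
  have "endpoint w \<in> path_points w"
    unfolding path_points_def by (auto intro!: exI[of _ "length w"])
  then show ?case by (auto simp: insert_absorb)
next
  case (Suc c)
  have "w @ replicate (Suc c) North = (w @ replicate c North) @ [North]"
    by (simp add: replicate_append_same)
  moreover have "{y..y + Suc c} = insert (y + Suc c) {y..y + c}" for y :: nat
    by auto
  ultimately show ?case
    by (simp add: path_points_snoc endpoint_snoc endpoint_append_North Suc.IH
        del: append_assoc replicate_Suc)
qed

lemma east_edge_snoc:
  "east_edge (w @ [s]) i y \<longleftrightarrow> east_edge w i y \<or> s = East \<and> endpoint w = (i, y)"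
proof -
  have "(\<exists>t<length w. (w @ [s]) ! t = East \<and> endpoint (take t (w @ [s])) = (i, y)) \<longleftrightarrow>
      east_edge w i y"
    unfolding east_edge_def by (intro ex_cong1 conj_cong refl) (simp_all add: nth_append)
  then show ?thesis
    unfolding east_edge_def[of "w @ [s]"] by (simp add: Ex_less_Suc) blast
qed

lemma east_edge_append_North: "east_edge (w @ replicate c North) i y \<longleftrightarrow> east_edge w i y"
proof (induction c)
  case (Suc c)
  then show ?case
    using east_edge_snoc[of "w @ replicate c North" North] by (simp add: replicate_append_same)
qed simp

text \<open>A nonempty prefix has left the origin, so only the very first step can be an edge
  starting there. This translates the prescribed first steps of the two boundary paths into
  conditions on column heights.\<close>

lemma east_edge_origin: "east_edge w 0 0 \<longleftrightarrow> (\<exists>w'. w = East # w')"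
proof
  assume "east_edge w 0 0"
  then obtain t where t: "t < length w" "w ! t = East" "endpoint (take t w) = (0, 0)"
    by (auto simp: east_edge_def)
  have "take t w = []"
  proof (cases "take t w")
    case (Cons s v)
    then show ?thesis using t(3) by (cases s) (auto simp: endpoint_def)
  qed
  then show "\<exists>w'. w = East # w'"
    using t by (cases w) auto
qed (auto simp: east_edge_def endpoint_def)

text \<open>The east step over column \<open>i\<close> runs at height \<open>g (Suc i)\<close>;
  index \<open>0\<close> is reserved for the starting height. The word ends with an east step, so a
  final run of north steps has to be appended separately.\<close>

primrec staircase :: "(nat \<Rightarrow> nat) \<Rightarrow> nat \<Rightarrow> step list" where
  "staircase g 0 = []"
| "staircase g (Suc n) = (staircase g n @ replicate (g (Suc n) - g n) North) @ [East]"

text \<open>Under this condition the subtractions in \<open>staircase\<close> do not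
  truncate.\<close>

definition rising :: "(nat \<Rightarrow> nat) \<Rightarrow> nat \<Rightarrow> bool" where
  "rising g n \<longleftrightarrow> g 0 = 0 \<and> (\<forall>i<n. g i \<le> g (Suc i))"

lemma rising_Suc: "rising g (Suc n) \<longleftrightarrow> rising g n \<and> g n \<le> g (Suc n)"
  by (auto simp: rising_def less_Suc_eq)

lemma endpoint_staircase: "rising g n \<Longrightarrow> endpoint (staircase g n) = (n, g n)"
proof (induction n)
  case 0
  then show ?case by (simp add: endpoint_def rising_def)
next
  case (Suc n)
  then show ?case
    by (simp add: rising_Suc endpoint_snoc endpoint_append_North del: append_assoc)
qed

text \<open>The run length \<open>c\<close> has to vary in the induction: up to its last east step,
  the longer staircase is the shorter one followed by north steps.\<close>

lemma path_points_staircase: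
  "rising g n \<Longrightarrow> path_points (staircase g n @ replicate c North) =
     {(i, y). i < n \<and> g i \<le> y \<and> y \<le> g (Suc i)} \<union> {n} \<times> {g n..g n + c}"
proof (induction n arbitrary: c)
  case 0
  have "path_points [] = {(0, 0)}" "endpoint [] = (0, 0)"
    by (simp_all add: path_points_def endpoint_def)
  moreover have "g 0 = 0"
    using 0 by (simp add: rising_def)
  moreover have "{(0, 0)} \<union> {0} \<times> {0..c} = {0 :: nat} \<times> {0..c}"
    by auto
  ultimately show ?case
    using path_points_append_North[of "[]" c] by simp
next
  case (Suc n)
  then have g: "rising g n" "g n \<le> g (Suc n)"
    by (auto simp: rising_Suc)
  have e: "endpoint (staircase g (Suc n)) = (Suc n, g (Suc n))"
    by (rule endpoint_staircase) fact
  have "path_points (staircase g (Suc n)) = insert (Suc n, g (Suc n))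
      (path_points (staircase g n @ replicate (g (Suc n) - g n) North))"
    using path_points_snoc[of "staircase g n @ replicate (g (Suc n) - g n) North" East] e
    unfolding staircase.simps by metis
  also have "path_points (staircase g n @ replicate (g (Suc n) - g n) North) =
      {(i, y). i < n \<and> g i \<le> y \<and> y \<le> g (Suc i)} \<union> {n} \<times> {g n..g (Suc n)}"
    using Suc.IH[OF g(1), of "g (Suc n) - g n"] g(2) by simp
  also have "\<dots> = {(i, y). i < Suc n \<and> g i \<le> y \<and> y \<le> g (Suc i)}"
    by (auto simp: less_Suc_eq)
  finally show ?case
    unfolding path_points_append_North e by auto
qed

lemma east_edge_staircase:
  "rising g n \<Longrightarrow> east_edge (staircase g n @ replicate c North) i y \<longleftrightarrow> i < n \<and> y = g (Suc i)"
proof (induction n arbitrary: c)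
  case 0
  show ?case unfolding east_edge_append_North by (simp add: east_edge_def)
next
  case (Suc n)
  then have g: "rising g n" "g n \<le> g (Suc n)"
    by (auto simp: rising_Suc)
  have "endpoint (staircase g n @ replicate (g (Suc n) - g n) North) = (n, g (Suc n))"
    using g by (simp add: endpoint_append_North endpoint_staircase)
  then have "east_edge (staircase g (Suc n)) i y \<longleftrightarrow> i < n \<and> y = g (Suc i) \<or> i = n \<and> y = g (Suc n)"
    unfolding staircase.simps east_edge_snoc Suc.IH[OF g(1)] by auto
  then show ?case
    unfolding east_edge_append_North by (auto simp: less_Suc_eq)
qed

lemma staircase_cong: "(\<And>i. i \<le> n \<Longrightarrow> g i = g' i) \<Longrightarrow> staircase g n = staircase g' n"
  by (induction n) auto

text \<open>Induction from the right end of the word: a north step prolongs the trailing run, an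
  east step turns that run into a new height of the staircase.\<close>

lemma path_normal_form:
  obtains g n c where "rising g n" "w = staircase g n @ replicate c North"
proof -
  have "\<exists>g n c. rising g n \<and> w = staircase g n @ replicate c North"
  proof (induction w rule: rev_induct)
    case Nil
    show ?case
      by (rule exI[of _ "\<lambda>_. 0"], rule exI[of _ 0], rule exI[of _ 0]) (simp add: rising_def)
  next
    case (snoc s w)
    then obtain g n c where g: "rising g n" "w = staircase g n @ replicate c North"
      by blast
    show ?case
    proof (cases s)
      case North
      then have "w @ [s] = staircase g n @ replicate (Suc c) North"
        using g by (simp add: replicate_append_same)
      then show ?thesis using g by blast
    next
      case East
      \<comment> \<open>The pending \<open>c\<close> north steps determine the height of the new
        east step; the shorter staircase reads \<open>g\<close> only up to \<open>n\<close> and is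
        unaffected.\<close>
      let ?g = "g(Suc n := g n + c)"
      have "staircase ?g n = staircase g n"
        by (rule staircase_cong) auto
      then have "w @ [s] = staircase ?g (Suc n) @ replicate 0 North"
        using g East by simp
      moreover have "rising ?g (Suc n)"
        using g by (auto simp: rising_def)
      ultimately show ?thesis by blast
    qed
  qed
  then show ?thesis using that by blast
qed

section \<open>Parallelogram polyominoes by columns\<close>

text \<open>The columns are numbered \<open>0\<close> to \<open>n\<close>, so the width is
  \<open>Suc n\<close>, and \<open>b i\<close> is an exclusive bound. The strict inequality says
  that columns \<open>i\<close> and \<open>Suc i\<close> share the row
  \<open>a (Suc i)\<close>.\<close>

definition column_profile :: "nat \<Rightarrow> (nat \<Rightarrow> nat) \<Rightarrow> (nat \<Rightarrow> nat) \<Rightarrow> bool" where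
  "column_profile n a b \<longleftrightarrow> a 0 = 0 \<and> 0 < b 0 \<and>
     (\<forall>i<n. a i \<le> a (Suc i) \<and> a (Suc i) < b i \<and> b i \<le> b (Suc i))"

definition column_cells :: "nat \<Rightarrow> (nat \<Rightarrow> nat) \<Rightarrow> (nat \<Rightarrow> nat) \<Rightarrow> cell set" where
  "column_cells n a b = {(i, j). i \<le> n \<and> a i \<le> j \<and> j < b i}"

lemma column_profile_nonempty:
  assumes "column_profile n a b" "i \<le> n"
  shows "a i < b i"
  using assms by (cases i) (auto simp: column_profile_def less_le_trans Suc_le_eq)

lemma column_profile_mono:
  assumes "column_profile n a b" "i \<le> i'" "i' \<le> n"
  shows "a i \<le> a i'" "b i \<le> b i'"
proof -
  have "a i \<le> a i' \<and> b i \<le> b i'"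
    using assms(2,3)
  proof (induction i' rule: dec_induct)
    case (step k)
    then show ?case
      using assms(1) by (auto simp: column_profile_def Suc_le_eq intro: le_trans)
  qed simp
  then show "a i \<le> a i'" "b i \<le> b i'" by auto
qed

text \<open>Adjacency is symmetric, so a walk from each cell to one common cell \<open>p\<close>
  suffices.\<close>

lemma edge_connectedI:
  assumes "\<And>c. c \<in> P \<Longrightarrow> (c, p) \<in> {(a, b). a \<in> P \<and> b \<in> P \<and> edge_adjacent a b}\<^sup>*"
  shows "edge_connected P"
proof -
  let ?R = "{(a, b). a \<in> P \<and> b \<in> P \<and> edge_adjacent a b}"
  have "sym (?R\<^sup>*)"
    by (rule sym_rtrancl) (auto simp: sym_def edge_adjacent_def)
  then have "(c, d) \<in> ?R\<^sup>*" if "c \<in> P" "d \<in> P" for c d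
    using assms[OF that(1)] assms[OF that(2)] by (meson rtrancl_trans symD)
  then show ?thesis by (auto simp: edge_connected_def)
qed

text \<open>Every cell is joined to the origin: walk down to the bottom of its column, step left,
  which is possible because consecutive columns overlap, and repeat.\<close>

lemma edge_connected_column_cells:
  assumes "column_profile n a b"
  shows "edge_connected (column_cells n a b)"
proof (rule edge_connectedI)
  let ?P = "column_cells n a b"
  let ?R = "{(c, d). c \<in> ?P \<and> d \<in> ?P \<and> edge_adjacent c d}"
  have down: "((i, j), (i, j')) \<in> ?R\<^sup>*" if "i \<le> n" "a i \<le> j'" "j' \<le> j" "j < b i" for i j j'
    using that(3,4)
  proof (induction j rule: dec_induct)
    case (step k)
    have "((i, Suc k), (i, k)) \<in> ?R"
      using that step by (auto simp: column_cells_def edge_adjacent_def)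
    moreover have "((i, k), (i, j')) \<in> ?R\<^sup>*"
      using step by simp
    ultimately show ?case
      by (meson converse_rtrancl_into_rtrancl)
  qed simp
  have bottom: "((i, a i), (0, 0)) \<in> ?R\<^sup>*" if "i \<le> n" for i
    using that
  proof (induction i)
    case 0
    then show ?case using assms by (simp add: column_profile_def)
  next
    case (Suc i)
    then have *: "a i \<le> a (Suc i)" "a (Suc i) < b i" "a (Suc i) < b (Suc i)"
      using assms column_profile_nonempty[OF assms, of "Suc i"] by (auto simp: column_profile_def)
    then have "((Suc i, a (Suc i)), (i, a (Suc i))) \<in> ?R"
      using Suc.prems by (auto simp: column_cells_def edge_adjacent_def)
    moreover have "((i, a (Suc i)), (i, a i)) \<in> ?R\<^sup>*"
      using * Suc.prems by (intro down) auto
    ultimately show ?case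
      using Suc by (meson Suc_leD converse_rtrancl_into_rtrancl rtrancl_trans)
  qed
  show "(c, (0, 0)) \<in> ?R\<^sup>*" if "c \<in> ?P" for c
    using that down[of "fst c" "a (fst c)" "snd c"] bottom[of "fst c"]
    by (cases c) (auto simp: column_cells_def intro: rtrancl_trans)
qed

text \<open>The upper path is the staircase of the tops; the lower path is the staircase of the
  bottoms, closed by a north run along the last column.\<close>

lemma parallelogram_polyomino_column_cells:
  assumes "column_profile n a b"
  shows "parallelogram_polyomino (column_cells n a b)"
proof -
  \<comment> \<open>The shift by one matches the indexing of \<open>staircase\<close>, with starting
    height \<open>0\<close> in front.\<close>
  define ga where "ga = case_nat 0 a"
  define gb where "gb = case_nat 0 b"
  define c where "c = b n - a n"
  have ab: "a n < b n" by (rule column_profile_nonempty[OF assms]) simp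
  have ra: "rising ga (Suc n)" and rb: "rising gb (Suc n)"
    using assms by (auto simp: rising_def ga_def gb_def column_profile_def split: nat.split)
  define u where "u = staircase gb (Suc n) @ replicate 0 North"
  define l where "l = staircase ga (Suc n) @ replicate c North"
  have eu: "endpoint u = (Suc n, b n)" and el: "endpoint l = (Suc n, b n)"
    unfolding u_def l_def endpoint_append_North endpoint_staircase[OF ra] endpoint_staircase[OF rb]
    using ab by (simp_all add: ga_def gb_def c_def)
  have pu: "path_points u = {(i, y). i < Suc n \<and> gb i \<le> y \<and> y \<le> gb (Suc i)} \<union> {(Suc n, b n)}"
    unfolding u_def path_points_staircase[OF rb] by (simp add: gb_def)
  have pl: "path_points l =
      {(i, y). i < Suc n \<and> ga i \<le> y \<and> y \<le> ga (Suc i)} \<union> {Suc n} \<times> {a n..b n}"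
    unfolding l_def path_points_staircase[OF ra] using ab by (simp add: ga_def c_def)
  have "\<exists>l'. l = East # l'"
    unfolding east_edge_origin[symmetric] l_def east_edge_staircase[OF ra]
    using assms by (simp add: ga_def column_profile_def)
  moreover have "\<nexists>u'. u = East # u'"
    unfolding east_edge_origin[symmetric] u_def east_edge_staircase[OF rb]
    using assms by (simp add: gb_def column_profile_def)
  then have "\<exists>u'. u = North # u'"
    using eu step.exhaust by (cases u) (auto simp: endpoint_def)
  moreover have "path_points u \<inter> path_points l = {(0, 0), endpoint u}"
  proof -
    have "path_points u \<inter> path_points l \<subseteq> {(0, 0), (Suc n, b n)}"
    proof
      fix p
      assume p: "p \<in> path_points u \<inter> path_points l"
      obtain i y where iy: "p = (i, y)" by fastforce
      \<comment> \<open>At an inner abscissa \<open>Suc k\<close> the upper path stays at or above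
        \<open>b k\<close> and the lower one at or below \<open>a (Suc k)\<close>, so the overlap
        keeps them apart. At \<open>0\<close> the lower path contains only the origin, and at
        \<open>Suc n\<close> the upper path contains only its endpoint.\<close>
      consider "i = 0" | k where "i = Suc k" "k < n" | "i = Suc n"
        using p unfolding iy pu pl
        by (cases i) auto
      then show "p \<in> {(0, 0), (Suc n, b n)}"
      proof cases
        case 2
        then have "b k \<le> y" "y \<le> a (Suc k)"
          using p unfolding iy pu pl
          by (auto simp: ga_def gb_def)
        then show ?thesis
          using assms 2 by (auto simp: column_profile_def)
      qed (use p assms in \<open>auto simp: iy pu pl ga_def gb_def column_profile_def\<close>)
    qed
    moreover have "{(0, 0), (Suc n, b n)} \<subseteq> path_points u \<inter> path_points l"
      unfolding pu pl using ab by (auto simp: ga_def gb_def c_def)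
    ultimately show ?thesis using eu by auto
  qed
  moreover have "column_cells n a b = cells_between u l"
    unfolding cells_between_def column_cells_def u_def l_def
      east_edge_staircase[OF ra] east_edge_staircase[OF rb]
    by (auto simp: ga_def gb_def)
  ultimately show ?thesis
    using edge_connected_column_cells[OF assms] eu el
    unfolding parallelogram_polyomino_def by metis
qed

text \<open>Both paths are put into normal form. Their common endpoint makes the numbers of east
  steps agree, and the absence of inner meeting points yields the overlap of consecutive
  columns.\<close>

lemma parallelogram_polyomino_columns:
  assumes "parallelogram_polyomino P"
  obtains n a b where "column_profile n a b" "P = column_cells n a b"
proof -
  obtain u l u' l' where ul: "u = North # u'" "l = East # l'" "endpoint u = endpoint l"
    "path_points u \<inter> path_points l = {(0, 0), endpoint u}" "P = cells_between u l"
    using assms unfolding parallelogram_polyomino_def by blast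
  obtain gb N d where b: "rising gb N" "u = staircase gb N @ replicate d North"
    by (rule path_normal_form)
  obtain ga N' c where a: "rising ga N'" "l = staircase ga N' @ replicate c North"
    by (rule path_normal_form)
  have "endpoint u = (N, gb N + d)" "endpoint l = (N', ga N' + c)"
    unfolding a(2) b(2) endpoint_append_North endpoint_staircase[OF a(1)] endpoint_staircase[OF b(1)]
    by simp_all
  then have end_eq: "N' = N" "gb N + d = ga N + c" and eu: "endpoint u = (N, gb N + d)"
    using ul(3) by auto
  have pu: "path_points u = {(i, y). i < N \<and> gb i \<le> y \<and> y \<le> gb (Suc i)} \<union> {N} \<times> {gb N..gb N + d}"
    using path_points_staircase[OF b(1)] b(2) by simp
  have pl: "path_points l = {(i, y). i < N \<and> ga i \<le> y \<and> y \<le> ga (Suc i)} \<union> {N} \<times> {ga N..ga N + c}"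
    using path_points_staircase[OF a(1)] a(2) end_eq by simp
  have edge_u: "east_edge u i y \<longleftrightarrow> i < N \<and> y = gb (Suc i)" for i y
    using east_edge_staircase[OF b(1)] b(2) by simp
  have edge_l: "east_edge l i y \<longleftrightarrow> i < N \<and> y = ga (Suc i)" for i y
    using east_edge_staircase[OF a(1)] a(2) end_eq by simp
  have "0 < N" and a0: "ga (Suc 0) = 0"
    using east_edge_origin[of l] ul(2) unfolding edge_l by auto
  have b0: "0 < gb (Suc 0)"
    using east_edge_origin[of u] ul(1) \<open>0 < N\<close> unfolding edge_u by auto
  have mono: "ga i \<le> ga (Suc i)" "gb i \<le> gb (Suc i)" if "i < N" for i
    using a(1) b(1) that end_eq by (auto simp: rising_def)
  \<comment> \<open>Without overlap, the vertical run of the lower path at abscissa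
    \<open>Suc i\<close> would pass through \<open>gb (Suc i)\<close>, where the upper path arrives:
    a forbidden inner meeting point.\<close>
  have overlap: "ga (Suc (Suc i)) < gb (Suc i)" if "ga (Suc i) < gb (Suc i)" "Suc i < N" for i
  proof (rule ccontr)
    assume "\<not> ?thesis"
    then have "(Suc i, gb (Suc i)) \<in> path_points u \<inter> path_points l"
      using that mono[of "Suc i"] unfolding pu pl by auto
    then show False using ul(4) eu that by auto
  qed
  have below: "ga (Suc i) < gb (Suc i)" if "i < N" for i
    using that
  proof (induction i)
    case 0
    then show ?case using a0 b0 by simp
  next
    case (Suc i)
    then show ?case using overlap[of i] mono(2)[of "Suc i"] by simp
  qed
  obtain n where n: "N = Suc n"
    using \<open>0 < N\<close> gr0_implies_Suc by blast
  have "column_profile n (\<lambda>i. ga (Suc i)) (\<lambda>i. gb (Suc i))"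
    using a0 b0 below overlap mono by (auto simp: column_profile_def n)
  moreover have "P = column_cells n (\<lambda>i. ga (Suc i)) (\<lambda>i. gb (Suc i))"
    unfolding ul(5) cells_between_def edge_u edge_l column_cells_def n by auto
  ultimately show ?thesis using that by blast
qed

text \<open>Since bottoms increase weakly, column \<open>i\<close> starts at or below
  \<open>j'\<close>, and it reaches above \<open>j\<close>. This is what later rules out blocks that
  are too long.\<close>

lemma parallelogram_polyomino_corner:
  assumes "parallelogram_polyomino P" "(i, j) \<in> P" "(i', j') \<in> P" "i \<le> i'" "j' \<le> j"
  shows "(i, j') \<in> P"
proof -
  obtain n a b where P: "column_profile n a b" "P = column_cells n a b"
    using assms(1) by (rule parallelogram_polyomino_columns)
  then show ?thesis
    using assms(2-5) column_profile_mono(1)[OF P(1), of i i'] by (auto simp: column_cells_def)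
qed

section \<open>Dimensions, top row and rightmost column from the column data\<close>

lemma finite_column_cells: "finite (column_cells n a b)"
  by (rule finite_subset[of _ "Sigma {..n} (\<lambda>i. {..<b i})"]) (auto simp: column_cells_def)

context
  fixes n a b
  assumes profile: "column_profile n a b"
begin

lemma Max_fst_column_cells: "Max (fst ` column_cells n a b) = n"
proof (rule Max_eqI)
  show "n \<in> fst ` column_cells n a b"
    using column_profile_nonempty[OF profile, of n]
    by (auto simp: column_cells_def image_iff)
qed (auto simp: column_cells_def intro: finite_imageI finite_column_cells[unfolded column_cells_def])

lemma Max_snd_column_cells: "Max (snd ` column_cells n a b) = b n - 1"
proof (rule Max_eqI)
  have "(n, b n - 1) \<in> column_cells n a b"
    using column_profile_nonempty[OF profile, of n] by (auto simp: column_cells_def)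
  then show "b n - 1 \<in> snd ` column_cells n a b" by force
  show "y \<le> b n - 1" if "y \<in> snd ` column_cells n a b" for y
    using that column_profile_mono(2)[OF profile, of _ n] by (fastforce simp: column_cells_def)
qed (simp add: finite_column_cells)

lemma pp_width_column_cells: "pp_width (column_cells n a b) = Suc n"
  by (simp add: pp_width_def Max_fst_column_cells)

lemma pp_height_column_cells: "pp_height (column_cells n a b) = b n"
  using column_profile_nonempty[OF profile, of n] by (simp add: pp_height_def Max_snd_column_cells)

lemma right_column_column_cells: "right_column (column_cells n a b) = {n} \<times> {a n..<b n}"
  unfolding right_column_def Max_fst_column_cells by (auto simp: column_cells_def)

lemma top_row_column_cells: "top_row (column_cells n a b) = {i. i \<le> n \<and> b i = b n} \<times> {b n - 1}"
proof -
  have "a i \<le> b n - 1" "b i \<le> b n" "0 < b i" if "i \<le> n" for i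
    using column_profile_mono(2)[OF profile, of i n] column_profile_nonempty[OF profile, of i] that
    by linarith+
  then show ?thesis
    unfolding top_row_def Max_snd_column_cells by (force simp: column_cells_def)
qed

lemma full_height_right:
  assumes "b i = b n" "i \<le> i'" "i' \<le> n"
  shows "b i' = b n"
  using column_profile_mono(2)[OF profile assms(2,3)] column_profile_mono(2)[OF profile assms(3)]
    assms(1) by simp

text \<open>Tops increase weakly, so the columns of full height form a final segment. It contains
  \<open>w\<close> columns exactly when the \<open>w\<close>-th column from the right, number
  \<open>Suc n - w\<close>, belongs to it.\<close>

lemma card_top_row_bound:
  assumes "1 \<le> w" "w \<le> Suc n"
  shows "w \<le> card (top_row (column_cells n a b)) \<longleftrightarrow> b (Suc n - w) = b n"
proof -
  let ?T = "{i. i \<le> n \<and> b i = b n}"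
  have card_eq: "card (top_row (column_cells n a b)) = card ?T"
    by (simp add: top_row_column_cells card_cartesian_product)
  show ?thesis
  proof
    assume full: "b (Suc n - w) = b n"
    have "{Suc n - w..n} \<subseteq> ?T"
    proof
      fix i
      assume "i \<in> {Suc n - w..n}"
      then show "i \<in> ?T"
        using full_height_right[OF full, of i] by simp
    qed
    then have "card {Suc n - w..n} \<le> card ?T"
      by (intro card_mono) auto
    then show "w \<le> card (top_row (column_cells n a b))"
      using assms card_eq by simp
  next
    assume w: "w \<le> card (top_row (column_cells n a b))"
    show "b (Suc n - w) = b n"
    proof (rule ccontr)
      assume neq: "b (Suc n - w) \<noteq> b n"
      have "?T \<subseteq> {Suc n - w<..n}"
      proof
        fix i
        assume i: "i \<in> ?T"
        have "b i \<le> b (Suc n - w)" "b (Suc n - w) \<le> b n" if "i \<le> Suc n - w"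
          using assms that by (auto intro!: column_profile_mono(2)[OF profile])
        then show "i \<in> {Suc n - w<..n}" using i neq by force
      qed
      then have "card ?T \<le> card {Suc n - w<..n}"
        by (intro card_mono) auto
      then show False using w card_eq assms by simp
    qed
  qed
qed

text \<open>The last \<open>w\<close> columns all end at height \<open>b n\<close>, so the new row
  simply raises each of their tops by one.\<close>

lemma add_row_column_cells:
  assumes "1 \<le> w" "w \<le> card (top_row (column_cells n a b))" "w \<le> Suc n"
  defines "b' \<equiv> \<lambda>i. if Suc n - w \<le> i then Suc (b i) else b i"
  shows "column_profile n a b'"
    and "column_cells n a b \<union> new_row (column_cells n a b) w = column_cells n a b'"
proof -
  show "column_profile n a b'"
    using profile unfolding column_profile_def b'_def by (auto simp: le_Suc_eq less_Suc_eq)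
  have "b (Suc n - w) = b n"
    using card_top_row_bound[OF assms(1,3)] assms(2) by simp
  then have full: "b i = b n" if "Suc n - w \<le> i" "i \<le> n" for i
    using full_height_right that by blast
  have "(i, j) \<in> column_cells n a b \<union> new_row (column_cells n a b) w \<longleftrightarrow>
      (i, j) \<in> column_cells n a b'" for i j
  proof (cases "Suc n - w \<le> i \<and> i \<le> n")
    case True
    then show ?thesis
      using full[of i] column_profile_nonempty[OF profile, of i]
      unfolding new_row_def pp_width_column_cells pp_height_column_cells
      by (auto simp: column_cells_def b'_def)
  next
    case False
    then show ?thesis
      unfolding new_row_def pp_width_column_cells pp_height_column_cells
      by (auto simp: column_cells_def b'_def)
  qed
  then show "column_cells n a b \<union> new_row (column_cells n a b) w = column_cells n a b'"
    by auto
qed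

text \<open>The upper bound on \<open>v\<close> keeps the bottoms increasing; \<open>1 <= v\<close>
  makes the new column overlap the old last one.\<close>

lemma add_column_column_cells:
  assumes "1 \<le> v" "v \<le> b n - a n"
  shows "column_profile (Suc n) (a(Suc n := b n - v)) (b(Suc n := b n))"
    and "column_cells n a b \<union> new_column (column_cells n a b) v =
      column_cells (Suc n) (a(Suc n := b n - v)) (b(Suc n := b n))"
  using assms profile unfolding new_column_def pp_width_column_cells pp_height_column_cells
  by (auto simp: column_profile_def column_cells_def less_Suc_eq le_Suc_eq)

end

section \<open>Adding a row or a column to a polyomino\<close>

lemma card_top_row_le_width:
  assumes "parallelogram_polyomino P"
  shows "1 \<le> card (top_row P)" "card (top_row P) \<le> pp_width P"
proof -
  obtain n a b where P: "column_profile n a b" "P = column_cells n a b"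
    using assms by (rule parallelogram_polyomino_columns)
  have "card {i. i \<le> n \<and> b i = b n} \<le> card {..n}"
    by (rule card_mono) auto
  then show "card (top_row P) \<le> pp_width P"
    by (simp add: P pp_width_column_cells top_row_column_cells card_cartesian_product)
  \<comment> \<open>For \<open>w = 1\<close> the criterion compares \<open>b n\<close> with
    itself.\<close>
  show "1 \<le> card (top_row P)"
    using card_top_row_bound[OF P(1), of 1] P(2) by simp
qed

lemma card_right_column_le_height:
  assumes "parallelogram_polyomino P"
  shows "card (right_column P) \<le> pp_height P"
proof -
  obtain n a b where P: "column_profile n a b" "P = column_cells n a b"
    using assms by (rule parallelogram_polyomino_columns)
  then show ?thesis
    by (simp add: right_column_column_cells pp_height_column_cells card_cartesian_product)
qed

text \<open>The first four facts serve to apply the rule \<open>horizontal\<close>; the last two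
  give the transition of top row width and rightmost column height. Right alignment puts a new cell
  on the last column.\<close>

lemma add_row:
  assumes "parallelogram_polyomino P" "1 \<le> w" "w \<le> card (top_row P)"
  defines "Q \<equiv> P \<union> new_row P w"
  shows "parallelogram_polyomino Q" "pp_size Q = Suc (pp_size P)" "Q - top_row Q = P"
    "top_row Q = new_row P w" "card (top_row Q) = w"
    "card (right_column Q) = Suc (card (right_column P))"
proof -
  obtain n a b where P: "column_profile n a b" "P = column_cells n a b"
    using assms(1) by (rule parallelogram_polyomino_columns)
  define b' where "b' = (\<lambda>i. if Suc n - w \<le> i then Suc (b i) else b i)"
  have w: "w \<le> Suc n"
    using card_top_row_le_width[OF assms(1)] assms(3) pp_width_column_cells[OF P(1)] P(2) by simp
  have Q: "column_profile n a b'" "Q = column_cells n a b'"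
    using add_row_column_cells[OF P(1) assms(2) _ w] assms(3) P(2) by (auto simp: b'_def Q_def)
  have b'n: "b' n = Suc (b n)" and ab: "a n < b n"
    using assms(2) column_profile_nonempty[OF P(1)] by (auto simp: b'_def)
  have disj: "P \<inter> new_row P w = {}"
    unfolding new_row_def P(2) pp_height_column_cells[OF P(1)]
    using column_profile_mono(2)[OF P(1), of _ n] by (fastforce simp: column_cells_def)
  show "parallelogram_polyomino Q"
    using parallelogram_polyomino_column_cells[OF Q(1)] Q(2) by simp
  show "pp_size Q = Suc (pp_size P)"
    using b'n by (simp add: pp_size_def P Q pp_width_column_cells pp_height_column_cells)
  have "b (Suc n - w) = b n"
    using card_top_row_bound[OF P(1) assms(2) w] assms(3) P(2) by simp
  then have bi: "b i = b n" if "Suc n - w \<le> i" "i \<le> n" for i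
    using full_height_right[OF P(1)] that by blast
  \<comment> \<open>Only the raised columns attain the new maximal height, so they alone form the
    new top row.\<close>
  have "b' i = Suc (b n) \<longleftrightarrow> Suc n - w \<le> i" if "i \<le> n" for i
    using that bi[of i] column_profile_mono(2)[OF P(1), of i n] by (auto simp: b'_def)
  then show top: "top_row Q = new_row P w"
    unfolding Q(2) top_row_column_cells[OF Q(1)] new_row_def P(2)
      pp_width_column_cells[OF P(1)] pp_height_column_cells[OF P(1)] b'n
    by auto
  show "Q - top_row Q = P"
    unfolding top using disj by (auto simp: Q_def)
  show "card (top_row Q) = w"
    unfolding top new_row_def P(2) pp_width_column_cells[OF P(1)]
    using w by (simp add: card_cartesian_product)
  show "card (right_column Q) = Suc (card (right_column P))"
    unfolding Q(2) P(2) right_column_column_cells[OF Q(1)] right_column_column_cells[OF P(1)]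
    using b'n ab by (simp add: card_cartesian_product)
qed

text \<open>The corner property forces an old cell directly below the leftmost new one, hence column
  \<open>Suc n - w\<close> already has full height.\<close>

lemma add_row_bound:
  assumes "parallelogram_polyomino P" "parallelogram_polyomino (P \<union> new_row P w)"
    "1 \<le> w" "w \<le> pp_width P"
  shows "w \<le> card (top_row P)"
proof -
  obtain n a b where P: "column_profile n a b" "P = column_cells n a b"
    using assms(1) by (rule parallelogram_polyomino_columns)
  have w: "w \<le> Suc n"
    using assms(4) pp_width_column_cells[OF P(1)] P(2) by simp
  have ab: "a n < b n"
    by (rule column_profile_nonempty[OF P(1)]) simp
  have row: "new_row P w = {Suc n - w..<Suc n} \<times> {b n}"
    by (simp add: new_row_def P pp_width_column_cells pp_height_column_cells)
  \<comment> \<open>The corner is spanned by the leftmost new cell and the top cell of the last old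
    column.\<close>
  have "(Suc n - w, b n - 1) \<in> P \<union> new_row P w"
  proof (rule parallelogram_polyomino_corner[OF assms(2)])
    show "(Suc n - w, b n) \<in> P \<union> new_row P w"
      using assms(3) w by (auto simp: row)
    show "(n, b n - 1) \<in> P \<union> new_row P w"
      using ab by (auto simp: P(2) column_cells_def)
  qed (use assms(3) in auto)
  then have "b n - 1 < b (Suc n - w)"
    using ab unfolding row by (auto simp: P(2) column_cells_def)
  moreover have "b (Suc n - w) \<le> b n"
    using assms(3) by (intro column_profile_mono(2)[OF P(1)]) auto
  ultimately show ?thesis
    using card_top_row_bound[OF P(1) assms(3) w] P(2) by simp
qed

lemma add_column:
  assumes "parallelogram_polyomino P" "1 \<le> v" "v \<le> card (right_column P)"
  defines "Q \<equiv> P \<union> new_column P v"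
  shows "parallelogram_polyomino Q" "pp_size Q = Suc (pp_size P)" "Q - right_column Q = P"
    "right_column Q = new_column P v" "card (top_row Q) = Suc (card (top_row P))"
    "card (right_column Q) = v"
proof -
  obtain n a b where P: "column_profile n a b" "P = column_cells n a b"
    using assms(1) by (rule parallelogram_polyomino_columns)
  have v: "v \<le> b n - a n"
    using assms(3) by (simp add: P right_column_column_cells card_cartesian_product)
  let ?a = "a(Suc n := b n - v)" and ?b = "b(Suc n := b n)"
  have Q: "column_profile (Suc n) ?a ?b" "Q = column_cells (Suc n) ?a ?b"
    using add_column_column_cells[OF P(1) assms(2) v] P(2) by (auto simp: Q_def)
  have ab: "a n < b n"
    by (rule column_profile_nonempty[OF P(1)]) simp
  show "parallelogram_polyomino Q"
    using parallelogram_polyomino_column_cells[OF Q(1)] Q(2) by simp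
  show "pp_size Q = Suc (pp_size P)"
    using P(1) Q(1) by (simp add: pp_size_def P(2) Q(2) pp_width_column_cells pp_height_column_cells)
  show right: "right_column Q = new_column P v"
    unfolding Q(2) P(2) right_column_column_cells[OF Q(1)] new_column_def
      pp_width_column_cells[OF P(1)] pp_height_column_cells[OF P(1)] by simp
  have "P \<inter> new_column P v = {}"
    unfolding new_column_def P(2) pp_width_column_cells[OF P(1)] by (auto simp: column_cells_def)
  then show "Q - right_column Q = P"
    unfolding right by (auto simp: Q_def)
  have "{i. i \<le> Suc n \<and> ?b i = ?b (Suc n)} = insert (Suc n) {i. i \<le> n \<and> b i = b n}"
    by (auto simp: le_Suc_eq)
  then show "card (top_row Q) = Suc (card (top_row P))"
    unfolding Q(2) P(2) top_row_column_cells[OF Q(1)] top_row_column_cells[OF P(1)]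
    by (simp add: card_cartesian_product)
  show "card (right_column Q) = v"
    unfolding Q(2) right_column_column_cells[OF Q(1)]
    using v ab by (simp add: card_cartesian_product)
qed

text \<open>The corner property forces an old cell directly to the left of the lowest new one, so
  the old last column reaches down at least as far.\<close>

lemma add_column_bound:
  assumes "parallelogram_polyomino P" "parallelogram_polyomino (P \<union> new_column P v)"
    "1 \<le> v" "v \<le> pp_height P"
  shows "v \<le> card (right_column P)"
proof -
  obtain n a b where P: "column_profile n a b" "P = column_cells n a b"
    using assms(1) by (rule parallelogram_polyomino_columns)
  have v: "v \<le> b n"
    using assms(4) pp_height_column_cells[OF P(1)] P(2) by simp
  have ab: "a n < b n"
    by (rule column_profile_nonempty[OF P(1)]) simp
  have col: "new_column P v = {Suc n} \<times> {b n - v..<b n}"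
    by (simp add: new_column_def P pp_width_column_cells pp_height_column_cells)
  have "(n, b n - v) \<in> P \<union> new_column P v"
  proof (rule parallelogram_polyomino_corner[OF assms(2)])
    show "(n, b n - 1) \<in> P \<union> new_column P v"
      using ab by (auto simp: P(2) column_cells_def)
    show "(Suc n, b n - v) \<in> P \<union> new_column P v"
      using assms(3) v by (auto simp: col)
  qed (use assms(3) in auto)
  then have "a n \<le> b n - v"
    unfolding col by (auto simp: P(2) column_cells_def)
  then show ?thesis
    using v ab by (simp add: P right_column_column_cells card_cartesian_product)
qed

section \<open>Slicings\<close>

lemma single_cell_columns: "{(0, 0)} = column_cells 0 (\<lambda>_. 0) (\<lambda>_. 1)"
  by (auto simp: column_cells_def)

lemma column_profile_single_cell: "column_profile 0 (\<lambda>_. 0) (\<lambda>_. 1)"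
  by (simp add: column_profile_def)

text \<open>Case analysis suffices: both recursive rules have these facts among their premises, so
  only the single cell is computed.\<close>

lemma baxter_slicing_polyomino:
  assumes "baxter_slicing n S"
  shows "parallelogram_polyomino (fst S)" "pp_size (fst S) = n"
proof -
  have "parallelogram_polyomino (fst S) \<and> pp_size (fst S) = n"
    using assms
  proof cases
    case single
    then show ?thesis
      using parallelogram_polyomino_column_cells[OF column_profile_single_cell]
        pp_width_column_cells[OF column_profile_single_cell]
        pp_height_column_cells[OF column_profile_single_cell]
      by (simp add: single_cell_def single_cell_columns pp_size_def)
  qed auto
  then show "parallelogram_polyomino (fst S)" "pp_size (fst S) = n" by auto
qed

lemma row_restricted_slicing_polyomino:
  "row_restricted_slicing m S \<Longrightarrow> parallelogram_polyomino (fst S)"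
  using baxter_slicing_polyomino(1) unfolding row_restricted_slicing_def by blast

text \<open>From left to right, only the shape of the result and the width of the new block matter,
  not how the result arises as a slicing. From right to left, the new row is the last block in rule
  \<open>horizontal\<close>.\<close>

lemma row_restricted_add_row_iff:
  assumes S: "row_restricted_slicing m S" and w: "1 \<le> w" "w \<le> pp_width (fst S)"
  shows "row_restricted_slicing m (add_block (new_row (fst S) w) S) \<longleftrightarrow>
    w \<le> m \<and> w \<le> card (top_row (fst S))"
proof -
  let ?P = "fst S"
  have P: "parallelogram_polyomino ?P"
    using S by (rule row_restricted_slicing_polyomino)
  have "fst ` new_row ?P w = {pp_width ?P - w..<pp_width ?P}"
    by (simp add: new_row_def)
  then have card_row: "card (fst ` new_row ?P w) = w"
    using w by simp
  have hor: "horizontal_block (new_row ?P w)"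
    by (auto simp: horizontal_block_def new_row_def)
  show ?thesis
  proof
    assume R: "row_restricted_slicing m (add_block (new_row ?P w) S)"
    then have "parallelogram_polyomino (?P \<union> new_row ?P w)"
      using row_restricted_slicing_polyomino by (fastforce simp: add_block_def)
    then show "w \<le> m \<and> w \<le> card (top_row ?P)"
      using R add_row_bound[OF P _ w] hor card_row
      by (auto simp: row_restricted_slicing_def add_block_def)
  next
    assume wm: "w \<le> m \<and> w \<le> card (top_row ?P)"
    note row = add_row[OF P w(1) conjunct2[OF wm]]
    obtain n where n: "baxter_slicing n S"
      using S by (auto simp: row_restricted_slicing_def)
    then have "baxter_slicing (Suc n) (?P \<union> new_row ?P w, insert (top_row (?P \<union> new_row ?P w)) (snd S))"
      using row(1-3) baxter_slicing_polyomino(2)[OF n] by (intro baxter_slicing.horizontal) auto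
    then show "row_restricted_slicing m (add_block (new_row ?P w) S)"
      using S wm card_row unfolding row(4) by (auto simp: row_restricted_slicing_def add_block_def)
  qed
qed

lemma row_restricted_add_column_iff:
  assumes S: "row_restricted_slicing m S" and v: "1 \<le> v" "v \<le> pp_height (fst S)" and m: "1 \<le> m"
  shows "row_restricted_slicing m (add_block (new_column (fst S) v) S) \<longleftrightarrow>
    v \<le> card (right_column (fst S))"
proof -
  let ?P = "fst S"
  have P: "parallelogram_polyomino ?P"
    using S by (rule row_restricted_slicing_polyomino)
  \<comment> \<open>A column has width at most 1, so it respects the restriction even when, as a
    single cell, it counts as horizontal.\<close>
  have "fst ` new_column ?P v \<subseteq> {pp_width ?P}"
    by (auto simp: new_column_def)
  then have "card (fst ` new_column ?P v) \<le> card {pp_width ?P}"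
    by (intro card_mono) auto
  then have card_col: "card (fst ` new_column ?P v) \<le> m"
    using m by simp
  show ?thesis
  proof
    assume "row_restricted_slicing m (add_block (new_column ?P v) S)"
    then have "parallelogram_polyomino (?P \<union> new_column ?P v)"
      using row_restricted_slicing_polyomino by (fastforce simp: add_block_def)
    then show "v \<le> card (right_column ?P)"
      using add_column_bound[OF P _ v] by blast
  next
    assume vk: "v \<le> card (right_column ?P)"
    note column = add_column[OF P v(1) vk]
    obtain n where n: "baxter_slicing n S"
      using S by (auto simp: row_restricted_slicing_def)
    then have "baxter_slicing (Suc n)
        (?P \<union> new_column ?P v, insert (right_column (?P \<union> new_column ?P v)) (snd S))"
      using column(1-3) baxter_slicing_polyomino(2)[OF n] by (intro baxter_slicing.vertical) auto
    then show "row_restricted_slicing m (add_block (new_column ?P v) S)"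
      using S card_col unfolding column(4) by (auto simp: row_restricted_slicing_def add_block_def)
  qed
qed

section \<open>Addable blocks, labels and distinctness of children\<close>

lemma addable_widths_eq:
  assumes "row_restricted_slicing m S"
  shows "addable_widths m S = {1..min m (card (top_row (fst S)))}"
  using row_restricted_add_row_iff[OF assms]
    card_top_row_le_width(2)[OF row_restricted_slicing_polyomino[OF assms]]
  by (auto simp: addable_widths_def)

lemma addable_heights_eq:
  assumes "row_restricted_slicing m S" "1 \<le> m"
  shows "addable_heights m S = {1..card (right_column (fst S))}"
  using row_restricted_add_column_iff[OF assms(1) _ _ assms(2)]
    card_right_column_le_height[OF row_restricted_slicing_polyomino[OF assms(1)]]
  by (auto simp: addable_heights_def)

lemma label_eq:
  assumes "row_restricted_slicing m S" "1 \<le> m"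
  shows "label m S = (min m (card (top_row (fst S))), card (right_column (fst S)))"
proof -
  \<comment> \<open>The interval is nonempty since both \<open>m\<close> and the top row width are
    at least 1.\<close>
  have "Max {1..min m (card (top_row (fst S)))} = min m (card (top_row (fst S)))"
    using assms card_top_row_le_width(1)[OF row_restricted_slicing_polyomino[OF assms(1)]]
    by (intro Max_eqI) auto
  then show ?thesis
    by (simp only: label_def addable_widths_eq[OF assms(1)])
qed

lemma label_single_cell:
  assumes "1 \<le> m"
  shows "label m single_cell = (1, 1)"
proof -
  have "row_restricted_slicing m single_cell"
    using assms baxter_slicing.single by (auto simp: row_restricted_slicing_def single_cell_def)
  moreover have "top_row {(0, 0)} = {(0, 0)}" "right_column {(0, 0)} = {(0, 0)}"
    by (auto simp: top_row_def right_column_def)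
  ultimately show ?thesis
    using assms by (subst label_eq) (auto simp: single_cell_def)
qed

text \<open>The new row is disjoint from the polyomino, so it can be recovered from the union, and
  its cardinality is the width. Injectivity ensures that the set of children keeps the
  multiplicities of the labels.\<close>

lemma inj_on_new_row:
  assumes P: "parallelogram_polyomino (fst S)"
  shows "inj_on (\<lambda>w. add_block (new_row (fst S) w) S) {1..pp_width (fst S)}"
proof (rule inj_onI)
  fix w w'
  let ?P = "fst S"
  assume w: "w \<in> {1..pp_width ?P}" "w' \<in> {1..pp_width ?P}"
    and eq: "add_block (new_row ?P w) S = add_block (new_row ?P w') S"
  have "finite ?P"
    using parallelogram_polyomino_columns[OF P] finite_column_cells by metis
  then have "snd c < pp_height ?P" if "c \<in> ?P" for c
    using that by (simp add: pp_height_def less_Suc_eq_le)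
  then have "?P \<inter> new_row ?P x = {}" for x
    by (fastforce simp: new_row_def)
  then have "new_row ?P w = new_row ?P w'"
    using eq unfolding add_block_def by blast
  then have "card (new_row ?P w) = card (new_row ?P w')"
    by simp
  then show "w = w'"
    using w by (simp add: new_row_def card_cartesian_product)
qed

lemma inj_on_new_column:
  assumes P: "parallelogram_polyomino (fst S)"
  shows "inj_on (\<lambda>v. add_block (new_column (fst S) v) S) {1..pp_height (fst S)}"
proof (rule inj_onI)
  fix v v'
  let ?P = "fst S"
  assume v: "v \<in> {1..pp_height ?P}" "v' \<in> {1..pp_height ?P}"
    and eq: "add_block (new_column ?P v) S = add_block (new_column ?P v') S"
  have "finite ?P"
    using parallelogram_polyomino_columns[OF P] finite_column_cells by metis
  then have "fst c < pp_width ?P" if "c \<in> ?P" for c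
    using that by (simp add: pp_width_def less_Suc_eq_le)
  then have "?P \<inter> new_column ?P x = {}" for x
    by (fastforce simp: new_column_def)
  then have "new_column ?P v = new_column ?P v'"
    using eq unfolding add_block_def by blast
  then have "card (new_column ?P v) = card (new_column ?P v')"
    by simp
  then show "v = v'"
    using v by (simp add: new_column_def card_cartesian_product)
qed

text \<open>The rightmost cell of the new row lies above the old polyomino and to the left of any
  new column.\<close>

lemma add_row_neq_add_column:
  assumes "parallelogram_polyomino (fst S)" "1 \<le> w" "w \<le> pp_width (fst S)"
  shows "add_block (new_row (fst S) w) S \<noteq> add_block (new_column (fst S) v) S"
proof
  let ?P = "fst S"
  assume eq: "add_block (new_row ?P w) S = add_block (new_column ?P v) S"
  have "finite ?P"
    using parallelogram_polyomino_columns[OF assms(1)] finite_column_cells by metis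
  then have "snd c < pp_height ?P" if "c \<in> ?P" for c
    using that by (simp add: pp_height_def less_Suc_eq_le)
  then have "(pp_width ?P - 1, pp_height ?P) \<notin> ?P" by fastforce
  moreover have "(pp_width ?P - 1, pp_height ?P) \<in> new_row ?P w"
    using assms(2,3) by (auto simp: new_row_def)
  moreover have "(pp_width ?P - 1, pp_height ?P) \<notin> new_column ?P v"
    by (auto simp: new_column_def)
  ultimately show False
    using eq unfolding add_block_def by blast
qed

theorem theorem11:
  fixes m :: nat
  assumes "m \<ge> 1"
  shows "label m single_cell = (1, 1) \<and>
    (\<forall>S h k. row_restricted_slicing m S \<and> label m S = (h, k) \<longrightarrow>
       finite (children m S) \<and>
       {#label m S'. S' \<in># mset_set (children m S)#} = upsilon_rule m h k)"
proof (intro conjI allI impI label_single_cell[OF assms]; elim conjE)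
  fix S h k
  assume S: "row_restricted_slicing m S" and hk: "label m S = (h, k)"
  let ?P = "fst S"
  let ?row = "\<lambda>w. add_block (new_row ?P w) S" and ?col = "\<lambda>v. add_block (new_column ?P v) S"
  have P: "parallelogram_polyomino ?P"
    using S by (rule row_restricted_slicing_polyomino)
  have h: "h = min m (card (top_row ?P))" and k: "k = card (right_column ?P)"
    using hk label_eq[OF S assms] by auto
  have widths: "h \<le> pp_width ?P" and heights: "k \<le> pp_height ?P"
    using card_top_row_le_width(2)[OF P] card_right_column_le_height[OF P] h k by auto
  have children: "children m S = ?row ` {1..h} \<union> ?col ` {1..k}"
    unfolding children_def addable_widths_eq[OF S] addable_heights_eq[OF S assms] h k ..
  show "finite (children m S)"
    by (simp add: children)
  \<comment> \<open>As \<open>w <= h <= m\<close>, the cap at \<open>m\<close> leaves the new top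
    row width unchanged.\<close>
  have row_label: "label m (?row w) = (w, k + 1)" if "w \<in> {1..h}" for w
  proof -
    have w: "1 \<le> w" "w \<le> m" "w \<le> card (top_row ?P)" "w \<le> pp_width ?P"
      using that h widths by auto
    then have "row_restricted_slicing m (?row w)"
      using row_restricted_add_row_iff[OF S] by blast
    then show ?thesis
      using label_eq[OF _ assms] add_row(5,6)[OF P w(1,3)] w k by (simp add: add_block_def)
  qed
  \<comment> \<open>The top row width \<open>r\<close> grows to \<open>r + 1\<close>, and capping
    \<open>r\<close> at \<open>m\<close> beforehand does not change the capped successor. The single
    term \<open>min m (Suc h)\<close> covers both \<open>h < m\<close> and
    \<open>h = m\<close>.\<close>
  have col_label: "label m (?col v) = (min m (Suc h), v)" if "v \<in> {1..k}" for v
  proof -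
    have v: "1 \<le> v" "v \<le> card (right_column ?P)" "v \<le> pp_height ?P"
      using that k heights by auto
    then have "row_restricted_slicing m (?col v)"
      using row_restricted_add_column_iff[OF S _ _ assms] by blast
    then show ?thesis
      using label_eq[OF _ assms] add_column(5,6)[OF P v(1,2)] h by (auto simp: add_block_def)
  qed
  have "mset_set (children m S) = mset_set (?row ` {1..h}) + mset_set (?col ` {1..k})"
    unfolding children
  proof (rule mset_set_Union)
    have "?row w \<noteq> ?col v" if "w \<in> {1..h}" for w v
      using add_row_neq_add_column[OF P, of w v] that widths by simp
    then show "?row ` {1..h} \<inter> ?col ` {1..k} = {}"
      by blast
  qed auto
  also have "mset_set (?row ` {1..h}) = image_mset ?row (mset_set {1..h})"
    using inj_on_subset[OF inj_on_new_row[OF P]] widths by (intro image_mset_mset_set[symmetric]) auto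
  also have "mset_set (?col ` {1..k}) = image_mset ?col (mset_set {1..k})"
    using inj_on_subset[OF inj_on_new_column[OF P]] heights
    by (intro image_mset_mset_set[symmetric]) auto
  finally have "{#label m S'. S' \<in># mset_set (children m S)#} =
      {#label m (?row w). w \<in># mset_set {1..h}#} + {#label m (?col v). v \<in># mset_set {1..k}#}"
    by (simp add: multiset.map_comp comp_def)
  also have "{#label m (?row w). w \<in># mset_set {1..h}#} = {#(w, k + 1). w \<in># mset_set {1..h}#}"
    using row_label by (intro image_mset_cong) simp
  also have "{#label m (?col v). v \<in># mset_set {1..k}#} =
      {#(min m (Suc h), v). v \<in># mset_set {1..k}#}"
    using col_label by (intro image_mset_cong) simp
  also have "{#(w, k + 1). w \<in># mset_set {1..h}#} + {#(min m (Suc h), v). v \<in># mset_set {1..k}#} =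
      upsilon_rule m h k"
  proof -
    \<comment> \<open>Because \<open>h <= m\<close>, exactly one of the two conditions in
      \<open>upsilon_rule\<close> holds.\<close>
    have "h \<le> m" "min m (Suc h) = (if h < m then h + 1 else m)"
      using h by auto
    then show ?thesis by (auto simp only: upsilon_rule_def split: if_split) simp_all
  qed
  finally show "{#label m S'. S' \<in># mset_set (children m S)#} = upsilon_rule m h k" .
qed

end
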